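(* Let $p\ge2$ be a real number and let $0<b<\pi_p/2$. Then the best possible constants $\alpha_2$ and $\beta_2$ such that the inequalities $$e^{\alpha_2x^p}<\frac{x}{\tan_p x}<e^{\beta_2x^p}$$ hold for all $x\in(0,b)$ are $\alpha_2=\dfrac{\ln(b/\tan_p b)}{b^p}$ and $\beta_2=-\dfrac{1}{p+1}$ respectively. Here "best possible" means that the inequalities hold for all $x\in(0,b)$ with these constants, and that $\alpha_2$ cannot be replaced by any larger constant, nor $\beta_2$ by any smaller constant, so that the respective inequality still holds for all $x\in(0,b)$.
   Context: For real $1<p<\infty$, define $\arcsin_p:[0,1]\to\mathbb{R}$ by $\arcsin_p(x)=\int_0^x\frac{dt}{(1-t^p)^{1/p}}$, and let $\pi_p=2\arcsin_p(1)=\frac{2\pi}{p\sin(\pi/p)}$. The generalized sine function $\sin_p:[0,\pi_p/2]\to[0,1]$ is the inverse of $\arcsin_p$. The generalized cosine function is $\cos_p x=\frac{d}{dx}\sin_p x$ for $x\in[0,\pi_p/2]$ (equivalently $\cos_p x=(1-\sin_p^p x)^{1/p}$, where $\sin_p^p x=(\sin_p x)^p$). The generalized tangent function is $\tan_p x=\frac{\sin_p x}{\cos_p x}$ for $x\in[0,\pi_p/2)$. *)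

theory Defs
  imports "HOL-Analysis.Analysis"
begin

text \<open>
  The generalized trigonometric functions for a real parameter \<open>p > 1\<close>. The functions below are
  only meaningful on the domains mentioned; outside of these domains their values are unspecified.
\<close>

text \<open>
  Domain \<open>{0..1}\<close>. For \<open>x = 1\<close> the integrand is unbounded near \<open>1\<close>; the Henstock--Kurzweil
  integral covers this (absolutely convergent) improper integral, and the totalised value of the
  integrand at the single point \<open>t = 1\<close> is irrelevant.
\<close>
definition arcsin_p :: "real \<Rightarrow> real \<Rightarrow> real" where
  "arcsin_p p x = integral {0..x} (\<lambda>t. 1 / (1 - t powr p) powr (1 / p))"

definition pi_p :: "real \<Rightarrow> real" where
  "pi_p p = 2 * arcsin_p p 1"

text \<open>Domain \<open>{0..pi_p p / 2}\<close>.\<close>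
definition sin_p :: "real \<Rightarrow> real \<Rightarrow> real" where
  "sin_p p = the_inv_into {0..1} (arcsin_p p)"

text \<open>
  Domain \<open>{0..pi_p p / 2}\<close>. The derivative is taken within this interval, hence is one-sided at
  the two end points.
\<close>
definition cos_p :: "real \<Rightarrow> real \<Rightarrow> real" where
  "cos_p p x = vector_derivative (sin_p p) (at x within {0..pi_p p / 2})"

text \<open>Domain \<open>{0..<pi_p p / 2}\<close>.\<close>
definition tan_p :: "real \<Rightarrow> real \<Rightarrow> real" where
  "tan_p p x = sin_p p x / cos_p p x"

end

theory Submission
  imports Defs
begin

text \<open>
  The function \<open>rate x = ln (x / tan_p p x) / x powr p\<close> decreases strictly on the interval
  \<open>(0, pi_p p / 2)\<close> and tends to \<open>- 1 / (p + 1)\<close> at \<open>0\<close>. Taking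
  logarithms turns the two inequalities for a constant \<open>c\<close> into \<open>c < rate x\<close> and
  \<open>rate x < c\<close>, so on \<open>(0, b)\<close> the best constants are the value \<open>rate b\<close> and the
  limit at \<open>0\<close>; both are approached but not attained.

  The only facts about the tangent that matter are the initial value problem
  \<open>T' = 1 + T powr p\<close>, \<open>T 0 = 0\<close>, and the positivity of \<open>T\<close>. Put
  \<open>W = 1 / (1 + T powr p)\<close> and \<open>Z = T * W / x\<close> (for the tangent, \<open>W\<close> is the
  \<open>p\<close>-th power of the cosine). Up to a positive factor,
  \<open>rate'\<close> is \<open>1 - 1 / Z - p * ln (x / T)\<close>. This expression vanishes at \<open>0\<close>, and
  its derivative is a negative multiple of
  \<open>barrier = Z^2 - k * Z + k - W\<close>, where \<open>k = (p - 1) / p\<close>. Hence everything rests on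
  \<open>barrier > 0\<close>.

  With respect to \<open>ln x\<close> the pair \<open>(W, Z)\<close> solves an autonomous system with a rational
  right-hand side, and it tends to \<open>(1, 1)\<close>, where the barrier vanishes, as \<open>x\<close> tends
  to \<open>0\<close>. The inequality \<open>barrier_slope_pos\<close> says that the barrier increases wherever
  it is not positive. So it cannot take a negative minimum, nor can it return to \<open>0\<close>.
\<close>

section \<open>The equation \<open>T' = 1 + T powr p\<close>\<close>

text \<open>
  The right-hand side is, up to the factor \<open>p\<close>, the derivative of the barrier with respect to
  \<open>ln x\<close>; the last assumption says that the barrier is not positive. Multiplied by \<open>z\<close>,
  the expression is quadratic in \<open>w\<close>. Its expansion around the zero
  \<open>w0 = z^2 - k * z + k\<close> of the barrier shows a positive value at \<open>w0\<close> and
  a nonnegative increment from \<open>w0\<close> to \<open>w\<close>; the latter uses \<open>k < z\<close>, which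
  follows from \<open>w0 \<le> w < z\<close> since \<open>z - w0 = (1 - z) * (z - k)\<close>.
\<close>
lemma barrier_slope_pos:
  fixes k z w :: real
  assumes k: "0 < k" "k < 1" and z: "0 < z" "z < 1"
    and wz: "w < z" and w: "z\<^sup>2 - k * z + k \<le> w"
  shows "0 < (2 * z - k) * (w - 1 + (1 - k) * (1 - z)) + (1 - w) * w / z"
proof -
  define w0 where "w0 = z\<^sup>2 - k * z + k"
  have "(1 - z) * (z - k) = z - w0"
    by (simp add: w0_def algebra_simps power2_eq_square)
  moreover have "0 < z - w0" using w wz by (simp add: w0_def)
  ultimately have "0 < (1 - z) * (z - k)" by simp
  then have kz: "k < z" using z by (simp add: zero_less_mult_iff)
  have eq: "z * ((2 * z - k) * (w - 1 + (1 - k) * (1 - z)) + (1 - w) * w / z)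
      = (1 - z)\<^sup>2 * (z\<^sup>2 + k * z + k * (1 - k)) + (w - w0) * ((1 - z)\<^sup>2 + (z - w) + (z - k))"
    using z by (simp add: w0_def field_simps) (simp add: algebra_simps power2_eq_square)
  have "0 < (1 - z)\<^sup>2 * (z\<^sup>2 + k * z + k * (1 - k))"
    using k z by (intro mult_pos_pos add_pos_pos) auto
  moreover have "0 \<le> (w - w0) * ((1 - z)\<^sup>2 + (z - w) + (z - k))"
    using w wz kz by (intro mult_nonneg_nonneg add_nonneg_nonneg) (auto simp: w0_def)
  ultimately have "0 < z * ((2 * z - k) * (w - 1 + (1 - k) * (1 - z)) + (1 - w) * w / z)"
    unfolding eq by linarith
  then show ?thesis using z by (simp add: zero_less_mult_iff)
qed

lemma powr_lim: "0 < c \<Longrightarrow> ((\<lambda>x::real. x powr c) \<longlongrightarrow> 0) (at_right 0)"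
  by (rule tendsto_zero_powrI[OF tendsto_ident_at tendsto_const]) (auto simp: eventually_at_filter)

locale tangent_equation =
  fixes p B :: real and T :: "real \<Rightarrow> real"
  assumes p: "1 < p" and B: "0 < B"
    and T_pos: "\<And>x. 0 < x \<Longrightarrow> x < B \<Longrightarrow> 0 < T x"
    and T_deriv: "\<And>x. 0 < x \<Longrightarrow> x < B \<Longrightarrow> (T has_real_derivative 1 + T x powr p) (at x)"
    and T_lim: "(T \<longlongrightarrow> 0) (at_right 0)"
begin

text \<open>
  For \<open>T = tan_p p\<close> the first two functions are \<open>W = cos_p^p\<close> and
  \<open>Z x = sin_p x * cos_p x^(p - 1) / x\<close>. Both have derivatives that are rational
  in \<open>W\<close>, \<open>Z\<close> and \<open>x\<close>, since \<open>1 / T = W / (x * Z)\<close>.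
\<close>

definition W :: "real \<Rightarrow> real" where "W x = 1 / (1 + T x powr p)"
definition Z :: "real \<Rightarrow> real" where "Z x = T x * W x / x"
definition k :: real where "k = (p - 1) / p"
definition barrier :: "real \<Rightarrow> real" where "barrier x = (Z x)\<^sup>2 - k * Z x + k - W x"

lemma k_bounds: "0 < k" "k < 1"
  using p by (auto simp: k_def)

lemma eventually_in_domain: "eventually (\<lambda>x. 0 < x \<and> x < B) (at_right 0)"
  using eventually_at_right_real[OF B] by simp

lemma denom_pos: "0 < 1 + T x powr p"
  by (smt (verit) powr_ge_zero)

lemma W_pos: "0 < W x"
  using denom_pos by (simp add: W_def)

lemma one_minus_W: "1 - W x = T x powr p * W x"
  using denom_pos[of x] by (simp add: W_def field_simps)

lemma T_powr_pred: "0 < x \<Longrightarrow> x < B \<Longrightarrow> T x powr (p - 1) = T x powr p / T x"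
  using T_pos[of x] by (simp add: powr_diff)

lemma W_deriv:
  assumes "0 < x" "x < B"
  shows "(W has_real_derivative - (p * (1 - W x) / T x)) (at x)"
proof -
  have "(W has_real_derivative
      - (p * T x powr (p - 1) * (1 + T x powr p)) / (1 + T x powr p)\<^sup>2) (at x)"
    unfolding W_def[abs_def]
    using T_pos[OF assms] denom_pos[of x]
    by (auto intro!: derivative_eq_intros T_deriv[OF assms] simp: power2_eq_square powr_diff field_simps)
  moreover have "- (p * T x powr (p - 1) * (1 + T x powr p)) / (1 + T x powr p)\<^sup>2
      = - (p * (1 - W x) / T x)"
    using T_pos[OF assms] denom_pos[of x]
    by (simp add: W_def T_powr_pred[OF assms] power2_eq_square) (simp add: field_simps)
  ultimately show ?thesis by simp
qed

lemma TW_deriv: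
  assumes "0 < x" "x < B"
  shows "((\<lambda>x. T x * W x) has_real_derivative 1 - p * (1 - W x)) (at x)"
  using T_pos[OF assms] denom_pos[of x]
  by (auto intro!: derivative_eq_intros T_deriv[OF assms] W_deriv[OF assms])
     (simp add: W_def)

lemma Z_deriv:
  assumes "0 < x" "x < B"
  shows "(Z has_real_derivative (1 - p * (1 - W x) - Z x) / x) (at x)"
proof -
  have "((\<lambda>x. T x * W x / x) has_real_derivative
      ((1 - p * (1 - W x)) * x - T x * W x * 1) / (x * x)) (at x)"
    using assms by (intro DERIV_divide TW_deriv DERIV_ident) auto
  moreover have "((1 - p * (1 - W x)) * x - T x * W x * 1) / (x * x) = (1 - p * (1 - W x) - Z x) / x"
    using assms by (simp add: Z_def diff_divide_distrib)
  moreover have "Z = (\<lambda>x. T x * W x / x)" by (simp add: Z_def[abs_def])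
  ultimately show ?thesis by simp
qed

lemma T_powr_lim: "((\<lambda>x. T x powr p) \<longlongrightarrow> 0) (at_right 0)"
proof (rule tendsto_zero_powrI[OF T_lim tendsto_const])
  show "\<forall>\<^sub>F x in at_right 0. 0 \<le> T x"
    using eventually_in_domain by eventually_elim (simp add: T_pos less_imp_le)
qed (use p in simp)

lemma W_lim: "(W \<longlongrightarrow> 1) (at_right 0)"
proof -
  have "((\<lambda>x. 1 / (1 + T x powr p)) \<longlongrightarrow> 1 / (1 + 0)) (at_right 0)"
    by (intro tendsto_intros T_powr_lim) auto
  then show ?thesis by (simp add: W_def[abs_def])
qed

lemma T_over_x_lim: "((\<lambda>x. T x / x) \<longlongrightarrow> 1) (at_right 0)"
proof (rule lhopital_right_0[where f' = "\<lambda>x. 1 + T x powr p" and g' = "\<lambda>_. 1"])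
  show "((\<lambda>x. (1 + T x powr p) / 1) \<longlongrightarrow> 1) (at_right 0)"
    using tendsto_add[OF tendsto_const T_powr_lim, of 1] by simp
  show "eventually (\<lambda>x. (T has_real_derivative 1 + T x powr p) (at x)) (at_right 0)"
    using eventually_in_domain by eventually_elim (auto intro: T_deriv)
qed (auto intro: T_lim tendsto_ident_at simp: eventually_at_filter)

lemma Z_lim: "(Z \<longlongrightarrow> 1) (at_right 0)"
  using tendsto_mult[OF T_over_x_lim W_lim] by (simp add: Z_def[abs_def])

lemma barrier_lim: "(barrier \<longlongrightarrow> 0) (at_right 0)"
proof -
  have "(barrier \<longlongrightarrow> 1\<^sup>2 - k * 1 + k - 1) (at_right 0)"
    unfolding barrier_def[abs_def] by (intro tendsto_intros Z_lim W_lim)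
  then show ?thesis by simp
qed

text \<open>
  A function on the open interval has no value at \<open>0\<close> to compare with. By monotonicity
  the limit bounds \<open>f (x / 2)\<close> from below, and from \<open>x / 2\<close> to \<open>x\<close> the increase is
  strict.
\<close>
lemma pos_if_deriv_pos_and_lim_0:
  fixes f :: "real \<Rightarrow> real"
  assumes der: "\<And>y. 0 < y \<Longrightarrow> y < B \<Longrightarrow> (f has_real_derivative f' y) (at y)"
    and pos: "\<And>y. 0 < y \<Longrightarrow> y < B \<Longrightarrow> 0 < f' y"
    and lim: "(f \<longlongrightarrow> 0) (at_right 0)" and x: "0 < x" "x < B"
  shows "0 < f x"
proof -
  have less: "f u < f v" if "0 < u" "u < v" "v < B" for u v
  proof (rule DERIV_pos_imp_increasing[OF that(2)])
    fix y assume "u \<le> y" "y \<le> v"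
    with that have "0 < y" "y < B" by auto
    then show "\<exists>D. (f has_real_derivative D) (at y) \<and> 0 < D" using der pos by blast
  qed
  have "0 \<le> f (x / 2)"
  proof (rule tendsto_upperbound[OF lim])
    have "eventually (\<lambda>y. 0 < y \<and> y < x / 2) (at_right 0)"
      using x eventually_at_right_real[of 0 "x/2"] by simp
    then show "eventually (\<lambda>y. f y \<le> f (x / 2)) (at_right 0)"
    proof eventually_elim
      case (elim y)
      then show ?case using less[of y "x / 2"] x by simp
    qed
  qed simp
  with less[of "x / 2" x] x show ?thesis by simp
qed

lemma x_less_T:
  assumes "0 < x" "x < B" shows "x < T x"
proof -
  have "0 < T x - x"
  proof (rule pos_if_deriv_pos_and_lim_0[where f = "\<lambda>x. T x - x" and f' = "\<lambda>y. T y powr p"])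
    show "((\<lambda>x. T x - x) has_real_derivative T y powr p) (at y)" if "0 < y" "y < B" for y
      using DERIV_diff[OF T_deriv[OF that] DERIV_ident] by simp
    show "((\<lambda>x. T x - x) \<longlongrightarrow> 0) (at_right 0)"
      using tendsto_diff[OF T_lim tendsto_ident_at] by simp
  next
    show "0 < T y powr p" if "0 < y" "y < B" for y using T_pos[OF that] by simp
  qed (use assms in simp_all)
  then show ?thesis by simp
qed

lemma W_less_1: "0 < x \<Longrightarrow> x < B \<Longrightarrow> W x < 1"
  using T_pos[of x] denom_pos[of x] by (simp add: W_def)

lemma TW_less_x:
  assumes "0 < x" "x < B" shows "T x * W x < x"
proof -
  have "0 < x - T x * W x"
  proof (rule pos_if_deriv_pos_and_lim_0[where f = "\<lambda>x. x - T x * W x" and f' = "\<lambda>y. p * (1 - W y)"])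
    show "((\<lambda>x. x - T x * W x) has_real_derivative p * (1 - W y)) (at y)"
      if "0 < y" "y < B" for y
      using DERIV_diff[OF DERIV_ident TW_deriv[OF that]] by simp
    show "((\<lambda>x. x - T x * W x) \<longlongrightarrow> 0) (at_right 0)"
      using tendsto_diff[OF tendsto_ident_at tendsto_mult[OF T_lim W_lim]] by simp
  next
    show "0 < p * (1 - W y)" if "0 < y" "y < B" for y using W_less_1[OF that] p by simp
  qed (use assms in simp_all)
  then show ?thesis by simp
qed

lemma Z_bounds:
  assumes "0 < x" "x < B"
  shows "0 < Z x" "Z x < 1" "W x < Z x"
  using TW_less_x[OF assms] x_less_T[OF assms] T_pos[OF assms] W_pos[of x] assms
  by (auto simp: Z_def field_simps)

lemma barrier_deriv:
  assumes "0 < x" "x < B"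
  shows "(barrier has_real_derivative
    p / x * ((2 * Z x - k) * (W x - 1 + (1 - k) * (1 - Z x)) + (1 - W x) * W x / Z x)) (at x)"
proof -
  have "(barrier has_real_derivative (2 * Z x - k) * D + E) (at x)"
    if "(Z has_real_derivative D) (at x)" "(W has_real_derivative - E) (at x)" for D E
    unfolding barrier_def[abs_def]
    by (auto intro!: derivative_eq_intros that simp: algebra_simps)
  from this[OF Z_deriv[OF assms] W_deriv[OF assms]]
  have "(barrier has_real_derivative (2 * Z x - k) * ((1 - p * (1 - W x) - Z x) / x)
      + p * (1 - W x) / T x) (at x)" .
  moreover have "1 - p * (1 - W x) - Z x = p * (W x - 1 + (1 - k) * (1 - Z x))"
    using p by (simp add: k_def field_simps)
  moreover have "p * (1 - W x) / T x = p / x * ((1 - W x) * W x / Z x)"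
    using T_pos[OF assms] W_pos[of x] assms by (simp add: Z_def)
  moreover have "a * (p * c / x) + p / x * d = p / x * (a * c + d)" for a c d
    by (simp add: distrib_left)
  ultimately show ?thesis by (simp only:)
qed

lemma barrier_deriv_pos_if_nonpos:
  assumes "0 < x" "x < B" "barrier x \<le> 0"
  obtains D where "(barrier has_real_derivative D) (at x)" "0 < D"
proof
  show "0 < p / x * ((2 * Z x - k) * (W x - 1 + (1 - k) * (1 - Z x)) + (1 - W x) * W x / Z x)"
    using assms p Z_bounds[OF assms(1,2)] k_bounds
    by (intro mult_pos_pos barrier_slope_pos) (auto simp: barrier_def)
qed (use barrier_deriv assms in blast)

text \<open>
  If the barrier is nonpositive at \<open>x\<close>, it is negative somewhere to the left of \<open>x\<close>.
  Since its limit at \<open>0\<close> is \<open>0\<close>, it then attains a negative minimum on some interval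
  \<open>{e..y}\<close> at a point other than \<open>e\<close>; but at that point it is increasing.
\<close>
lemma barrier_pos:
  assumes x: "0 < x" "x < B"
  shows "0 < barrier x"
proof (rule ccontr)
  assume "\<not> 0 < barrier x"
  then have "barrier x \<le> 0" by simp
  with x obtain D where "(barrier has_real_derivative D) (at x)" "0 < D"
    using barrier_deriv_pos_if_nonpos by blast
  then obtain d where d: "0 < d" "\<And>h. 0 < h \<Longrightarrow> h < d \<Longrightarrow> barrier (x - h) < barrier x"
    using DERIV_pos_inc_left by blast
  define h where "h = min (d / 2) (x / 2)"
  define y where "y = x - h"
  have h: "0 < h" "h < d" "h < x" using d(1) x by (auto simp: h_def)
  then have y: "0 < y" "y < B" "barrier y < 0"
    using d(2)[of h] x \<open>barrier x \<le> 0\<close> by (auto simp: y_def)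
  \<comment> \<open>A left end point at which the barrier exceeds \<open>barrier y\<close> keeps the minimum away from it.\<close>
  have "eventually (\<lambda>e. barrier y < barrier e) (at_right 0)"
    using order_tendstoD(1)[OF barrier_lim y(3)] .
  moreover have "eventually (\<lambda>e. 0 < e \<and> e < y) (at_right 0)"
    using y eventually_at_right_real[of 0 y] by simp
  ultimately have "eventually (\<lambda>e. barrier y < barrier e \<and> 0 < e \<and> e < y) (at_right 0)"
    by (rule eventually_conj)
  from eventually_happens'[OF trivial_limit_at_right_real this]
  obtain e where e: "0 < e" "e < y" "barrier y < barrier e" by blast
  have "continuous_on {e..y} barrier"
  proof (intro continuous_at_imp_continuous_on ballI)
    fix v assume "v \<in> {e..y}"
    then have "0 < v" "v < B" using e y by auto
    then show "isCont barrier v" by (rule DERIV_isCont[OF barrier_deriv])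
  qed
  then obtain m where m: "m \<in> {e..y}" "\<And>v. v \<in> {e..y} \<Longrightarrow> barrier m \<le> barrier v"
    using continuous_attains_inf[of "{e..y}" barrier] e by auto
  have "barrier m \<le> barrier y" using m e by simp
  then have "m \<noteq> e" "barrier m < 0" using e y by auto
  with m e y have me: "e < m" "0 < m" "m < B" by auto
  then obtain D where "(barrier has_real_derivative D) (at m)" "0 < D"
    using barrier_deriv_pos_if_nonpos[of m] \<open>barrier m < 0\<close> by (metis less_imp_le)
  then obtain d where d: "0 < d" "\<And>h. 0 < h \<Longrightarrow> h < d \<Longrightarrow> barrier (m - h) < barrier m"
    using DERIV_pos_inc_left by blast
  define h where "h = min (d / 2) (m - e)"
  have "0 < h" "h < d" using d(1) me by (auto simp: h_def)
  have "barrier (m - h) < barrier m" "m - h \<in> {e..y}"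
    using d(1) d(2)[of h] me m(1) by (auto simp: h_def)
  with m(2) show False by force
qed

definition logratio :: "real \<Rightarrow> real" where "logratio x = ln (x / T x)"

lemma logratio_deriv:
  assumes "0 < x" "x < B"
  shows "(logratio has_real_derivative (1 - 1 / Z x) / x) (at x)"
proof -
  have "(logratio has_real_derivative 1 / x - (1 + T x powr p) / T x) (at x)"
    unfolding logratio_def[abs_def] using assms T_pos[OF assms]
    by (auto intro!: derivative_eq_intros T_deriv[OF assms] simp: field_simps power2_eq_square)
  moreover have "1 / x - (1 + T x powr p) / T x = (1 - 1 / Z x) / x"
    using assms T_pos[OF assms] denom_pos[of x] by (simp add: Z_def W_def field_simps)
  ultimately show ?thesis by simp
qed

lemma logratio_lim: "(logratio \<longlongrightarrow> 0) (at_right 0)"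
proof -
  have "((\<lambda>x. ln (inverse (T x / x))) \<longlongrightarrow> ln (inverse 1)) (at_right 0)"
    by (intro tendsto_intros T_over_x_lim) auto
  then show ?thesis by (simp add: logratio_def[abs_def])
qed

text \<open>
  The expression is \<open>x * logratio' x - p * logratio x\<close>, the numerator of the derivative
  of \<open>rate\<close>. Differentiating it removes the logarithm, and what is left is a negative multiple
  of the barrier.
\<close>
lemma logratio_deficit_neg:
  assumes "0 < x" "x < B"
  shows "1 - 1 / Z x - p * logratio x < 0"
proof -
  have "0 < - (1 - 1 / Z x - p * logratio x)"
  proof (rule pos_if_deriv_pos_and_lim_0[where
        f = "\<lambda>x. - (1 - 1 / Z x - p * logratio x)" and f' = "\<lambda>y. p * barrier y / (y * (Z y)\<^sup>2)"])
    fix y assume y: "0 < y" "y < B"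
    note Z = Z_bounds[OF y]
    have "((\<lambda>x. - (1 - 1 / Z x - p * logratio x)) has_real_derivative
        - ((1 - p * (1 - W y) - Z y) / y / (Z y)\<^sup>2 - p * ((1 - 1 / Z y) / y))) (at y)"
      using Z by (auto intro!: derivative_eq_intros Z_deriv[OF y] logratio_deriv[OF y]
          simp: power2_eq_square)
    moreover have "- ((1 - p * (1 - W y) - Z y) / y / (Z y)\<^sup>2 - p * ((1 - 1 / Z y) / y))
        = p * barrier y / (y * (Z y)\<^sup>2)"
      using Z y p by (simp add: barrier_def k_def field_simps power2_eq_square)
    ultimately show "((\<lambda>x. - (1 - 1 / Z x - p * logratio x)) has_real_derivative
        p * barrier y / (y * (Z y)\<^sup>2)) (at y)" by simp
    show "0 < p * barrier y / (y * (Z y)\<^sup>2)"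
      using p barrier_pos[OF y] y Z by simp
  next
    have "((\<lambda>x. - (1 - 1 / Z x - p * logratio x)) \<longlongrightarrow> - (1 - 1 / 1 - p * 0)) (at_right 0)"
      by (intro tendsto_intros Z_lim logratio_lim) auto
    then show "((\<lambda>x. - (1 - 1 / Z x - p * logratio x)) \<longlongrightarrow> 0) (at_right 0)" by simp
  qed (use assms in auto)
  then show ?thesis by simp
qed

definition rate :: "real \<Rightarrow> real" where "rate x = logratio x / x powr p"

lemma rate_deriv:
  assumes "0 < x" "x < B"
  shows "(rate has_real_derivative (1 - 1 / Z x - p * logratio x) / (x * x powr p)) (at x)"
  unfolding rate_def[abs_def] using assms
  by (auto intro!: derivative_eq_intros logratio_deriv[OF assms]
      simp: powr_diff field_simps power2_eq_square)

lemma rate_strict_decreasing: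
  assumes "0 < x" "x < y" "y < B"
  shows "rate y < rate x"
proof (rule DERIV_neg_imp_decreasing[OF assms(2)])
  fix u assume "x \<le> u" "u \<le> y"
  with assms have u: "0 < u" "u < B" by auto
  then show "\<exists>D. (rate has_real_derivative D) (at u) \<and> D < 0"
    using rate_deriv[OF u] logratio_deficit_neg[OF u]
    by (intro exI conjI) (auto intro!: divide_neg_pos)
qed

text \<open>
  The quotient is \<open>(x - T * W) / x powr (p + 1)\<close>. One application of l'Hopital's
  rule suffices because \<open>(x - T * W)' = p * (1 - W) = p * T powr p * W\<close> and \<open>T / x\<close>
  tends to \<open>1\<close>.
\<close>
lemma Z_second_order:
  "((\<lambda>x. (1 - Z x) / x powr p) \<longlongrightarrow> p / (p + 1)) (at_right 0)"
proof -
  have pos: "eventually (\<lambda>x. x \<noteq> 0) (at_right (0::real))"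
    by (simp add: eventually_at_filter)
  have "((\<lambda>x. (x - T x * W x) / x powr (p + 1)) \<longlongrightarrow> p / (p + 1)) (at_right 0)"
  proof (rule lhopital_right_0[where f' = "\<lambda>x. p * (1 - W x)" and g' = "\<lambda>x. (p + 1) * x powr p"])
    show "((\<lambda>x. x - T x * W x) \<longlongrightarrow> 0) (at_right 0)"
      using tendsto_diff[OF tendsto_ident_at tendsto_mult[OF T_lim W_lim]] by simp
    show "((\<lambda>x::real. x powr (p + 1)) \<longlongrightarrow> 0) (at_right 0)"
      using powr_lim[of "p + 1"] p by simp
    show "\<forall>\<^sub>F x in at_right 0. x powr (p + 1) \<noteq> 0" "\<forall>\<^sub>F x in at_right 0. (p + 1) * x powr p \<noteq> 0"
      using pos p by (auto elim!: eventually_mono)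
    show "\<forall>\<^sub>F x in at_right 0. ((\<lambda>x. x - T x * W x) has_real_derivative p * (1 - W x)) (at x)"
      using eventually_in_domain
    proof eventually_elim
      case (elim x)
      then show ?case using DERIV_diff[OF DERIV_ident TW_deriv[of x]] by simp
    qed
    show "\<forall>\<^sub>F x in at_right 0. ((\<lambda>x. x powr (p + 1)) has_real_derivative (p + 1) * x powr p) (at x)"
      using eventually_in_domain
      by eventually_elim (auto intro!: derivative_eq_intros)
    have "((\<lambda>x. p / (p + 1) * ((T x / x) powr p * W x)) \<longlongrightarrow> p / (p + 1) * (1 powr p * 1)) (at_right 0)"
      by (intro tendsto_intros T_over_x_lim W_lim) auto
    moreover have "\<forall>\<^sub>F x in at_right 0. p / (p + 1) * ((T x / x) powr p * W x)
        = p * (1 - W x) / ((p + 1) * x powr p)"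
      using eventually_in_domain
    proof eventually_elim
      case (elim x)
      then show ?case
        using T_pos[of x] by (simp add: one_minus_W powr_divide)
    qed
    ultimately show "((\<lambda>x. p * (1 - W x) / ((p + 1) * x powr p)) \<longlongrightarrow> p / (p + 1)) (at_right 0)"
      by (simp add: Lim_transform_eventually)
  qed
  moreover have "\<forall>\<^sub>F x in at_right 0. (x - T x * W x) / x powr (p + 1) = (1 - Z x) / x powr p"
    using eventually_in_domain
    by eventually_elim (simp add: Z_def powr_add field_simps)
  ultimately show ?thesis
    by (rule Lim_transform_eventually)
qed

lemma rate_lim: "(rate \<longlongrightarrow> - (1 / (p + 1))) (at_right 0)"
  unfolding rate_def[abs_def]
proof (rule lhopital_right_0[where f' = "\<lambda>x. (1 - 1 / Z x) / x" and g' = "\<lambda>x. p * x powr (p - 1)"])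
  show "(logratio \<longlongrightarrow> 0) (at_right 0)" by (rule logratio_lim)
  show "((\<lambda>x::real. x powr p) \<longlongrightarrow> 0) (at_right 0)"
    using powr_lim[of p] p by simp
  have pos: "eventually (\<lambda>x. x \<noteq> 0) (at_right (0::real))"
    by (simp add: eventually_at_filter)
  show "\<forall>\<^sub>F x in at_right 0. x powr p \<noteq> 0" "\<forall>\<^sub>F x in at_right 0. p * x powr (p - 1) \<noteq> 0"
    using pos p by (auto elim!: eventually_mono)
  show "\<forall>\<^sub>F x in at_right 0. (logratio has_real_derivative (1 - 1 / Z x) / x) (at x)"
    using eventually_in_domain by eventually_elim (auto intro!: logratio_deriv)
  show "\<forall>\<^sub>F x in at_right 0. ((\<lambda>x. x powr p) has_real_derivative p * x powr (p - 1)) (at x)"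
    using eventually_in_domain
    by eventually_elim (auto intro!: derivative_eq_intros)
  have "((\<lambda>x. - ((1 - Z x) / x powr p) / (p * Z x)) \<longlongrightarrow> - (p / (p + 1)) / (p * 1)) (at_right 0)"
    using p by (intro tendsto_intros Z_second_order Z_lim) auto
  moreover have "\<forall>\<^sub>F x in at_right 0. - ((1 - Z x) / x powr p) / (p * Z x)
      = (1 - 1 / Z x) / x / (p * x powr (p - 1))"
    using eventually_in_domain
  proof eventually_elim
    case (elim x)
    then show ?case
      using p Z_bounds[of x] by (simp add: powr_diff field_simps)
  qed
  ultimately show "((\<lambda>x. (1 - 1 / Z x) / x / (p * x powr (p - 1))) \<longlongrightarrow> - (1 / (p + 1))) (at_right 0)"
    using p by (simp add: Lim_transform_eventually)
qed

text \<open>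
  Monotonicity alone gives only the weak inequality; comparing the limit with \<open>rate (x / 2)\<close>
  makes it strict.
\<close>
lemma rate_less_lim:
  assumes "0 < x" "x < B"
  shows "rate x < - (1 / (p + 1))"
proof -
  have "rate (x / 2) \<le> - (1 / (p + 1))"
  proof (rule tendsto_lowerbound[OF rate_lim])
    have "eventually (\<lambda>y. 0 < y \<and> y < x / 2) (at_right 0)"
      using assms eventually_at_right_real[of 0 "x/2"] by simp
    then show "eventually (\<lambda>y. rate (x / 2) \<le> rate y) (at_right 0)"
    proof eventually_elim
      case (elim y)
      then show ?case using rate_strict_decreasing[of y "x / 2"] assms by simp
    qed
  qed simp
  with rate_strict_decreasing[of "x / 2" x] assms show ?thesis by simp
qed

lemma exp_less_ratio_iff:
  assumes "0 < x" "x < B"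
  shows "exp (c * x powr p) < x / T x \<longleftrightarrow> c < rate x"
    and "x / T x < exp (c * x powr p) \<longleftrightarrow> rate x < c"
proof -
  have "x / T x = exp (rate x * x powr p)"
    using assms T_pos[OF assms] by (simp add: rate_def logratio_def)
  then show "exp (c * x powr p) < x / T x \<longleftrightarrow> c < rate x"
    "x / T x < exp (c * x powr p) \<longleftrightarrow> rate x < c"
    using assms by simp_all
qed

end

section \<open>The generalized sine\<close>

definition arcsin_p_integrand :: "real \<Rightarrow> real \<Rightarrow> real" where
  "arcsin_p_integrand p t = 1 / (1 - t powr p) powr (1 / p)"

lemma one_minus_powr_pos:
  assumes "1 < p" "0 \<le> y" "y < (1::real)"
  shows "0 < 1 - y powr p"
  using powr_less_mono2[of p y 1] assms by simp

text \<open>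
  Positivity of \<open>pi_p p\<close> stands in for the convergence of the improper integral: the
  integral of a function that is not integrable is \<open>0\<close> by convention.
\<close>
locale positive_pi_p =
  fixes p :: real
  assumes p: "1 < p" and pi_pos: "0 < pi_p p"
begin

lemma integrable: "arcsin_p_integrand p integrable_on {0..1}"
  using pi_pos not_integrable_integral[of "arcsin_p_integrand p" "{0..1}"]
  by (auto simp: pi_p_def arcsin_p_def arcsin_p_integrand_def[abs_def])

lemma arcsin_p_eq: "arcsin_p p = (\<lambda>x. integral {0..x} (arcsin_p_integrand p))"
  by (simp add: arcsin_p_def[abs_def] arcsin_p_integrand_def[abs_def])

lemma arcsin_p_0 [simp]: "arcsin_p p 0 = 0"
  by (simp add: arcsin_p_def)

lemma arcsin_p_1: "arcsin_p p 1 = pi_p p / 2"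
  by (simp add: pi_p_def)

lemma continuous_arcsin_p: "continuous_on {0..1} (arcsin_p p)"
  unfolding arcsin_p_eq by (rule indefinite_integral_continuous_1[OF integrable])

lemma arcsin_p_deriv:
  assumes "0 < y" "y < 1"
  shows "(arcsin_p p has_real_derivative 1 / (1 - y powr p) powr (1 / p)) (at y)"
proof -
  have pos: "0 < 1 - y powr p" using one_minus_powr_pos p assms by simp
  have "isCont (arcsin_p_integrand p) y"
    unfolding arcsin_p_integrand_def[abs_def]
    using assms pos by (intro continuous_intros) auto
  then have "((\<lambda>x. integral {0..x} (arcsin_p_integrand p)) has_vector_derivative
      arcsin_p_integrand p y) (at y within {0..1})"
    using integral_has_vector_derivative_continuous_at[OF integrable, of y "{}"] assms
    by (auto intro: continuous_at_imp_continuous_at_within)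
  then show ?thesis
    using assms by (simp add: arcsin_p_eq has_real_derivative_iff_has_vector_derivative
        arcsin_p_integrand_def at_within_Icc_at)
qed

lemma arcsin_p_less:
  assumes "0 \<le> x" "x < y" "y \<le> 1"
  shows "arcsin_p p x < arcsin_p p y"
proof (rule DERIV_pos_imp_increasing_open[OF assms(2)])
  fix u assume "x < u" "u < y"
  then have u: "0 < u" "u < 1" using assms by auto
  show "\<exists>D. (arcsin_p p has_real_derivative D) (at u) \<and> 0 < D"
  proof (intro exI conjI)
    show "0 < 1 / (1 - u powr p) powr (1 / p)"
      using one_minus_powr_pos[OF p, of u] u p by simp
  qed (rule arcsin_p_deriv[OF u])
qed (use continuous_on_subset[OF continuous_arcsin_p] assms in auto)

lemma inj_arcsin_p: "inj_on (arcsin_p p) {0..1}"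
  by (rule linorder_inj_onI) (use arcsin_p_less in force)+

lemma arcsin_p_image: "arcsin_p p ` {0..1} = {0..pi_p p / 2}"
proof
  show "arcsin_p p ` {0..1} \<subseteq> {0..pi_p p / 2}"
    using arcsin_p_less[of 0] arcsin_p_less[of _ 1] arcsin_p_1
    by (force simp: le_less)
  show "{0..pi_p p / 2} \<subseteq> arcsin_p p ` {0..1}"
    using IVT'[of "arcsin_p p" 0 _ 1] continuous_arcsin_p arcsin_p_1 by force
qed

lemma sin_p_arcsin_p: "y \<in> {0..1} \<Longrightarrow> sin_p p (arcsin_p p y) = y"
  unfolding sin_p_def by (rule the_inv_into_f_f[OF inj_arcsin_p])

lemma arcsin_p_sin_p: "x \<in> {0..pi_p p / 2} \<Longrightarrow> arcsin_p p (sin_p p x) = x"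
  using arcsin_p_image sin_p_arcsin_p by (metis imageE)

lemma sin_p_0 [simp]: "sin_p p 0 = 0"
  using sin_p_arcsin_p[of 0] by simp

lemma sin_p_bounds:
  assumes "0 < x" "x < pi_p p / 2"
  shows "0 < sin_p p x" "sin_p p x < 1"
proof -
  obtain y where y: "y \<in> {0..1}" "x = arcsin_p p y"
    using arcsin_p_image assms by (metis atLeastAtMost_iff imageE less_imp_le)
  then have "y \<noteq> 0" "y \<noteq> 1" using assms arcsin_p_1 by auto
  with y show "0 < sin_p p x" "sin_p p x < 1" by (auto simp: sin_p_arcsin_p)
qed

lemma continuous_sin_p: "continuous_on {0..pi_p p / 2} (sin_p p)"
  using continuous_on_inv[OF continuous_arcsin_p, of "sin_p p"] sin_p_arcsin_p arcsin_p_image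
  by auto

lemma sin_p_deriv:
  assumes "0 < x" "x < pi_p p / 2"
  shows "(sin_p p has_real_derivative (1 - sin_p p x powr p) powr (1 / p)) (at x)"
proof -
  note S = sin_p_bounds[OF assms]
  have pos: "0 < 1 - sin_p p x powr p" using one_minus_powr_pos p S by simp
  have "isCont (sin_p p) x"
    using continuous_on_interior[OF continuous_sin_p, of x] assms by simp
  then have "(sin_p p has_real_derivative inverse (1 / (1 - sin_p p x powr p) powr (1 / p))) (at x)"
    using pos assms arcsin_p_sin_p
    by (intro DERIV_inverse_function[where f = "arcsin_p p" and a = 0 and b = "pi_p p / 2"]
        arcsin_p_deriv S) auto
  then show ?thesis by simp
qed

lemma cos_p_eq:
  assumes "0 < x" "x < pi_p p / 2"
  shows "cos_p p x = (1 - sin_p p x powr p) powr (1 / p)"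
  unfolding cos_p_def
  using sin_p_deriv[OF assms] assms
  by (simp add: at_within_Icc_at vector_derivative_at has_real_derivative_iff_has_vector_derivative)

lemma tan_p_eq:
  assumes "0 < x" "x < pi_p p / 2"
  shows "tan_p p x = sin_p p x * (1 - sin_p p x powr p) powr (- (1 / p))"
  by (simp add: tan_p_def cos_p_eq[OF assms] powr_minus divide_inverse)

text \<open>
  With \<open>c = cos_p^p = 1 - sin_p^p\<close>, the product rule yields
  \<open>1 + sin_p^p / c\<close>.
\<close>
lemma tan_p_deriv:
  assumes x: "0 < x" "x < pi_p p / 2"
  shows "(tan_p p has_real_derivative 1 + tan_p p x powr p) (at x)"
proof -
  define S where "S = sin_p p"
  define c where "c = 1 - S x powr p"
  have S: "0 < S x" "S x < 1" using sin_p_bounds[OF x] by (simp_all add: S_def)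
  have c: "0 < c" using one_minus_powr_pos p S by (simp add: c_def)
  have S_deriv: "(S has_real_derivative c powr (1 / p)) (at x)"
    using sin_p_deriv[OF x] by (simp add: S_def c_def)
  have "((\<lambda>x. 1 - S x powr p) has_real_derivative - (p * S x powr (p - 1) * c powr (1 / p))) (at x)"
    using S by (auto intro!: derivative_eq_intros S_deriv simp: powr_diff)
  then have "((\<lambda>x. (1 - S x powr p) powr (- (1 / p))) has_real_derivative
      - (1 / p) * c powr (- (1 / p) - 1) * - (p * S x powr (p - 1) * c powr (1 / p))) (at x)"
    by (rule DERIV_chain2[where f = "\<lambda>z. z powr (- (1 / p))", rotated])
       (use has_real_derivative_powr[of c "- (1 / p)"] c in \<open>simp add: c_def\<close>)
  moreover have "c powr (- (1 / p) - 1) = 1 / (c powr (1 / p) * c)"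
    using c by (simp add: powr_diff powr_minus divide_inverse)
  then have "- (1 / p) * c powr (- (1 / p) - 1) * - (p * S x powr (p - 1) * c powr (1 / p))
      = S x powr (p - 1) / c"
    using c p by simp
  ultimately have "((\<lambda>x. (1 - S x powr p) powr (- (1 / p))) has_real_derivative
      S x powr (p - 1) / c) (at x)" by simp
  from DERIV_mult[OF S_deriv this]
  have "((\<lambda>x. S x * (1 - S x powr p) powr (- (1 / p))) has_real_derivative
      c powr (1 / p) * c powr (- (1 / p)) + S x powr (p - 1) / c * S x) (at x)"
    by (simp only: c_def)
  moreover have "c powr (1 / p) * c powr (- (1 / p)) + S x powr (p - 1) / c * S x
      = 1 + (S x * c powr (- (1 / p))) powr p"
  proof -
    have "(S x * c powr (- (1 / p))) powr p = S x powr p * c powr (- 1)"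
      using S p by (simp add: powr_mult powr_powr)
    then show ?thesis using c S by (simp add: powr_minus powr_diff divide_inverse)
  qed
  ultimately have D: "((\<lambda>x. S x * (1 - S x powr p) powr (- (1 / p))) has_real_derivative
      1 + (S x * c powr (- (1 / p))) powr p) (at x)" by simp
  have "(tan_p p has_real_derivative 1 + (S x * c powr (- (1 / p))) powr p) (at x)"
    using D
    by (rule has_field_derivative_transform_within_open[where S = "{0<..<pi_p p / 2}"])
       (use x tan_p_eq in \<open>auto simp: S_def c_def\<close>)
  then show ?thesis by (simp add: tan_p_eq[OF x] S_def c_def)
qed

lemma tan_p_lim: "(tan_p p \<longlongrightarrow> 0) (at_right 0)"
proof -
  have in_domain: "eventually (\<lambda>x. x \<in> {0<..<pi_p p / 2}) (at_right 0)"
    using eventually_at_right_real[of 0 "pi_p p / 2"] pi_pos by simp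
  have "(sin_p p \<longlongrightarrow> sin_p p 0) (at 0 within {0..pi_p p / 2})"
    using continuous_sin_p pi_pos unfolding continuous_on_def
    by (metis atLeastAtMost_iff half_gt_zero less_imp_le order_refl)
  then have S: "(sin_p p \<longlongrightarrow> 0) (at_right 0)"
    using pi_pos by (simp add: at_within_Icc_at_right)
  have "((\<lambda>x. sin_p p x powr p) \<longlongrightarrow> 0) (at_right 0)"
  proof (rule tendsto_zero_powrI[OF S tendsto_const])
    show "\<forall>\<^sub>F x in at_right 0. 0 \<le> sin_p p x"
      using in_domain by eventually_elim (simp add: sin_p_bounds less_imp_le)
  qed (use p in simp)
  then have "((\<lambda>x. sin_p p x * (1 - sin_p p x powr p) powr (- (1 / p))) \<longlongrightarrow>
      0 * (1 - 0) powr (- (1 / p))) (at_right 0)"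
    by (intro tendsto_intros S) auto
  moreover have "\<forall>\<^sub>F x in at_right 0. sin_p p x * (1 - sin_p p x powr p) powr (- (1 / p)) = tan_p p x"
    using in_domain by eventually_elim (simp add: tan_p_eq)
  ultimately show ?thesis
    by (simp add: Lim_transform_eventually)
qed

sublocale tangent_equation p "pi_p p / 2" "tan_p p"
proof
  fix x assume x: "0 < x" "x < pi_p p / 2"
  show "0 < tan_p p x"
    using sin_p_bounds[OF x] one_minus_powr_pos[OF p, of "sin_p p x"]
    using p by (simp add: tan_p_eq[OF x])
qed (use p pi_pos tan_p_deriv tan_p_lim in auto)

end

section \<open>The best constants\<close>

theorem theorem3p3:
  fixes p b \<alpha>\<^sub>2 \<beta>\<^sub>2 :: real
  assumes "p \<ge> 2"
    and "0 < b" and "b < pi_p p / 2"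
    and "\<alpha>\<^sub>2 = ln (b / tan_p p b) / b powr p"
    and "\<beta>\<^sub>2 = - (1 / (p + 1))"
  shows "(\<forall>x\<in>{0<..<b}. exp (\<alpha>\<^sub>2 * x powr p) < x / tan_p p x \<and>
                       x / tan_p p x < exp (\<beta>\<^sub>2 * x powr p))
    \<and> (\<forall>\<alpha>>\<alpha>\<^sub>2. \<not> (\<forall>x\<in>{0<..<b}. exp (\<alpha> * x powr p) < x / tan_p p x))
    \<and> (\<forall>\<beta><\<beta>\<^sub>2. \<not> (\<forall>x\<in>{0<..<b}. x / tan_p p x < exp (\<beta> * x powr p)))"
proof -
  interpret positive_pi_p p
    using assms by unfold_locales auto
  have \<alpha>: "\<alpha>\<^sub>2 = rate b"
    using assms by (simp add: rate_def logratio_def)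
  have less_rate: "exp (c * x powr p) < x / tan_p p x \<longleftrightarrow> c < rate x"
    and rate_less: "x / tan_p p x < exp (c * x powr p) \<longleftrightarrow> rate x < c"
    if "x \<in> {0<..<b}" for c x
    using that assms exp_less_ratio_iff[of x c] by auto
  have "rate b < rate x" "rate x < \<beta>\<^sub>2" if "x \<in> {0<..<b}" for x
    using that assms rate_strict_decreasing[of x b] rate_less_lim[of x] by auto
  moreover have "\<exists>x\<in>{0<..<b}. rate x < c" if "rate b < c" for c
  proof -
    have "isCont rate b" using rate_deriv[of b] assms by (auto intro: DERIV_isCont)
    then have "(rate \<longlongrightarrow> rate b) (at_left b)"
      by (simp add: isCont_def filterlim_at_split)
    then have "eventually (\<lambda>x. rate x < c) (at_left b)"
      using that by (rule order_tendstoD)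
    moreover have "eventually (\<lambda>x. x \<in> {0<..<b}) (at_left b)"
      using eventually_at_left_real[of 0 b] assms by simp
    ultimately have "eventually (\<lambda>x. rate x < c \<and> x \<in> {0<..<b}) (at_left b)"
      by (rule eventually_conj)
    from eventually_happens'[OF trivial_limit_at_left_real this] show ?thesis by blast
  qed
  moreover have "\<exists>x\<in>{0<..<b}. c < rate x" if "c < \<beta>\<^sub>2" for c
  proof -
    have "eventually (\<lambda>x. c < rate x) (at_right 0)"
      using rate_lim that assms by (auto intro: order_tendstoD)
    moreover have "eventually (\<lambda>x. x \<in> {0<..<b}) (at_right 0)"
      using eventually_at_right_real[of 0 b] assms by simp
    ultimately have "eventually (\<lambda>x. c < rate x \<and> x \<in> {0<..<b}) (at_right 0)"
      by (rule eventually_conj)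
    from eventually_happens'[OF trivial_limit_at_right_real this] show ?thesis by blast
  qed
  ultimately show ?thesis
    unfolding \<alpha> by (smt (verit, best) less_rate rate_less)
qed

end
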